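(* Let $G$ be a finite group such that for every $h\in G$ the twisted conjugacy class $[e]_h$ is a subgroup of $G$. Then $G$ is nilpotent.
   Context: For $h\in G$, $[e]_h=\{z^{-1}h^{-1}zh\mid z\in G\}$ is the twisted conjugacy class of the unit element $e$ with respect to the inner automorphism $x\mapsto h^{-1}xh$. *)

theory Defs
  imports "HOL-Algebra.Generated_Groups"
begin

definition conj_by :: "('a, 'b) monoid_scheme \<Rightarrow> 'a \<Rightarrow> 'a \<Rightarrow> 'a" where
  "conj_by G h = (\<lambda>x. inv\<^bsub>G\<^esub> h \<otimes>\<^bsub>G\<^esub> x \<otimes>\<^bsub>G\<^esub> h)"

(* Replacing z by its inverse gives the other common form z x \<phi>(z)^-1. *)
definition twisted_class ::
    "('a, 'b) monoid_scheme \<Rightarrow> ('a \<Rightarrow> 'a) \<Rightarrow> 'a \<Rightarrow> 'a set" where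
  "twisted_class G \<phi> x = {inv\<^bsub>G\<^esub> z \<otimes>\<^bsub>G\<^esub> x \<otimes>\<^bsub>G\<^esub> \<phi> z | z. z \<in> carrier G}"

lemma (in group) twisted_class_one_conj_by:
  assumes "h \<in> carrier G"
  shows "twisted_class G (conj_by G h) \<one> = {inv z \<otimes> inv h \<otimes> z \<otimes> h | z. z \<in> carrier G}"
proof -
  have "inv z \<otimes> \<one> \<otimes> conj_by G h z = inv z \<otimes> inv h \<otimes> z \<otimes> h" if "z \<in> carrier G" for z
    using that assms by (simp add: conj_by_def m_assoc)
  then show ?thesis
    unfolding twisted_class_def by (metis (no_types, lifting))
qed

definition commutator_subgroup ::
    "('a, 'b) monoid_scheme \<Rightarrow> 'a set \<Rightarrow> 'a set \<Rightarrow> 'a set" where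
  "commutator_subgroup G H K =
     generate G {inv\<^bsub>G\<^esub> x \<otimes>\<^bsub>G\<^esub> inv\<^bsub>G\<^esub> y \<otimes>\<^bsub>G\<^esub> x \<otimes>\<^bsub>G\<^esub> y | x y. x \<in> H \<and> y \<in> K}"

(* Indexed from 0, so that a group of class at most n has trivial n-th term. *)
primrec lower_central :: "('a, 'b) monoid_scheme \<Rightarrow> nat \<Rightarrow> 'a set" where
  "lower_central G 0 = carrier G"
| "lower_central G (Suc n) = commutator_subgroup G (lower_central G n) (carrier G)"

definition nilpotent_group :: "('a, 'b) monoid_scheme \<Rightarrow> bool" where
  "nilpotent_group G \<longleftrightarrow> group G \<and> (\<exists>n. lower_central G n = {\<one>\<^bsub>G\<^esub>})"

end

theory Submission
  imports Defs "HOL-Algebra.SndIsomorphismGrp"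
begin

text \<open>
  Let \<open>D(h)\<close> be the twisted class of \<open>\<one>\<close> under conjugation by \<open>h\<close>, that is, the set of all
  commutators \<open>[z, h]\<close>. The argument rests on three observations.

  If \<open>D(h)\<close> is a subgroup, it is automatically normal: the identity
  \<open>[z, h]\<^sup>y = [z y, h] [y, h]\<^sup>-\<^sup>1\<close> expresses a conjugate of a commutator through two others with
  the same second entry (\<open>normal_twisted_class\<close>).

  As \<open>D(h)\<close> consists of the quotients of conjugates of \<open>h\<^sup>-\<^sup>1\<close> by \<open>h\<^sup>-\<^sup>1\<close>, it can contain \<open>h\<close> modulo
  a normal subgroup \<open>M\<close> only if a conjugate of \<open>h\<^sup>-\<^sup>1\<close> is trivial modulo \<open>M\<close>, hence only if
  \<open>h \<in> M\<close> (\<open>twisted_class_mult_normal_imp_mem\<close>).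

  Now let \<open>K\<close> be a nontrivial normal subgroup and \<open>M\<close> maximal among the normal subgroups
  properly inside \<open>K\<close>. For \<open>h \<in> K - M\<close> the normal subgroup \<open>D(h) M\<close> lies in \<open>K\<close> and misses \<open>h\<close>, so
  it equals \<open>M\<close> by maximality; for \<open>h \<in> M\<close> normality of \<open>M\<close> gives \<open>D(h) \<subseteq> M\<close>. Therefore
  \<open>[K, G] \<subseteq> M\<close> (\<open>commutator_subgroup_subset_smaller_normal\<close>). So each step of the lower central
  series descends from a normal bound to a strictly smaller one, and in a finite group it
  reaches the trivial subgroup.
\<close>

context group
begin

lemma mem_twisted_class_one:
  assumes "h \<in> carrier G" "z \<in> carrier G"
  shows "inv z \<otimes> inv h \<otimes> z \<otimes> h \<in> twisted_class G (conj_by G h) \<one>"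
  using assms unfolding twisted_class_one_conj_by[OF assms(1)] by blast

lemma inv_mult_cancel: "\<lbrakk>x \<in> carrier G; y \<in> carrier G\<rbrakk> \<Longrightarrow> inv x \<otimes> (x \<otimes> y) = y"
  by (simp flip: m_assoc)

lemma mult_inv_cancel: "\<lbrakk>x \<in> carrier G; y \<in> carrier G\<rbrakk> \<Longrightarrow> x \<otimes> (inv x \<otimes> y) = y"
  by (simp flip: m_assoc)

lemma set_mult_memI: "\<lbrakk>a \<in> A; b \<in> B\<rbrakk> \<Longrightarrow> a \<otimes> b \<in> A <#> B"
  unfolding set_mult_def by blast

lemma normal_twisted_class:
  assumes h: "h \<in> carrier G"
    and D: "subgroup (twisted_class G (conj_by G h) \<one>) G"
  shows "twisted_class G (conj_by G h) \<one> \<lhd> G"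
proof (rule normal_invI[OF D])
  let ?D = "twisted_class G (conj_by G h) \<one>"
  fix x d
  assume x: "x \<in> carrier G" and "d \<in> ?D"
  then obtain z where z: "z \<in> carrier G" and d: "d = inv z \<otimes> inv h \<otimes> z \<otimes> h"
    unfolding twisted_class_one_conj_by[OF h] by blast
  define y where "y = inv x"
  have y: "y \<in> carrier G" "x = inv y"
    using x by (simp_all add: y_def)
  \<comment> \<open>The inner \<open>h\<close> and \<open>h\<^sup>-\<^sup>1\<close> cancel on the right-hand side, leaving \<open>d\<close> conjugated by \<open>y\<close>.\<close>
  have "x \<otimes> d \<otimes> inv x =
      (inv (z \<otimes> y) \<otimes> inv h \<otimes> (z \<otimes> y) \<otimes> h) \<otimes> inv (inv y \<otimes> inv h \<otimes> y \<otimes> h)"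
    using y z h by (simp add: d m_assoc inv_mult_group inv_mult_cancel mult_inv_cancel)
  also have "\<dots> \<in> ?D"
    using D y z h
    by (intro subgroup.m_closed[OF D] subgroup.m_inv_closed[OF D] mem_twisted_class_one) auto
  finally show "x \<otimes> d \<otimes> inv x \<in> ?D" .
qed

lemma twisted_class_subset_normal:
  assumes K: "K \<lhd> G" and h: "h \<in> K"
  shows "twisted_class G (conj_by G h) \<one> \<subseteq> K"
proof -
  interpret K: normal K G by (rule K)
  have "inv z \<otimes> inv h \<otimes> z \<otimes> h \<in> K" if "z \<in> carrier G" for z
    using that h by (intro K.m_closed K.inv_op_closed1) auto
  then show ?thesis
    using twisted_class_one_conj_by[OF K.mem_carrier[OF h]] by auto
qed

text \<open>
  If \<open>h = [z, h] m\<close>, then cancelling shows that a conjugate of \<open>h\<^sup>-\<^sup>1\<close> is a conjugate of \<open>m\<^sup>-\<^sup>1\<close>.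
\<close>

lemma twisted_class_mult_normal_imp_mem:
  assumes M: "M \<lhd> G" and h: "h \<in> carrier G"
    and mem: "h \<in> twisted_class G (conj_by G h) \<one> <#> M"
  shows "h \<in> M"
proof -
  interpret M: normal M G by (rule M)
  obtain z m where z: "z \<in> carrier G" and m: "m \<in> M"
    and eq: "h = inv z \<otimes> inv h \<otimes> z \<otimes> h \<otimes> m"
    using mem unfolding set_mult_def twisted_class_one_conj_by[OF h] by blast
  have mG: "m \<in> carrier G" using m by simp
  define c where "c = inv z \<otimes> inv h \<otimes> z"
  have c: "c \<in> carrier G" using z h by (simp add: c_def)
  have "c \<otimes> (h \<otimes> m) = h"
    using eq c h mG by (simp add: c_def m_assoc z)
  then have "c = h \<otimes> inv (h \<otimes> m)"
    using c h mG by (metis inv_solve_right m_closed)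
  also have "\<dots> = h \<otimes> inv m \<otimes> inv h"
    using h mG by (simp add: inv_mult_group m_assoc)
  finally have "c \<in> M"
    using M.inv_op_closed2[OF h] m by simp
  then have "z \<otimes> c \<otimes> inv z \<in> M"
    using M.inv_op_closed2[OF z] by blast
  moreover have "z \<otimes> c \<otimes> inv z = inv h"
    using z h by (simp add: c_def m_assoc mult_inv_cancel)
  ultimately show "h \<in> M"
    using h M.m_inv_closed by fastforce
qed

text \<open>
  A maximal \<open>M\<close> works: were \<open>D(h)\<close> not inside \<open>M\<close>, then \<open>D(h) M\<close> would be a normal subgroup strictly
  between \<open>M\<close> and \<open>K\<close>, as it omits \<open>h\<close>. This is where finiteness of the group enters.
\<close>

lemma commutator_subgroup_subset_smaller_normal:
  assumes fin: "finite (carrier G)"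
    and D: "\<And>h. h \<in> carrier G \<Longrightarrow> subgroup (twisted_class G (conj_by G h) \<one>) G"
    and K: "K \<lhd> G" and nontriv: "K \<noteq> {\<one>}"
  obtains M where "M \<lhd> G" "M \<subset> K" "commutator_subgroup G K (carrier G) \<subseteq> M"
proof -
  interpret K: normal K G by (rule K)
  let ?S = "{M. M \<lhd> G \<and> M \<subset> K}"
  have "?S \<subseteq> Pow (carrier G)"
    using K.subset by blast
  then have "finite ?S"
    using fin by (meson finite_Pow_iff finite_subset)
  moreover have "{\<one>} \<in> ?S"
    using one_is_normal nontriv by auto
  ultimately have "\<exists>M\<in>?S. \<forall>N\<in>?S. M \<subseteq> N \<longrightarrow> M = N"
    by (intro finite_has_maximal) auto
  then obtain M where "M \<in> ?S" and maximal: "\<forall>N\<in>?S. M \<subseteq> N \<longrightarrow> M = N"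
    by (rule bexE)
  then have M: "M \<lhd> G" "M \<subset> K" by auto
  interpret M: normal M G by (rule M)
  have class_subset: "twisted_class G (conj_by G h) \<one> \<subseteq> M" if h: "h \<in> K" for h
  proof (cases "h \<in> M")
    case True
    then show ?thesis by (rule twisted_class_subset_normal[OF M(1)])
  next
    case False
    let ?D = "twisted_class G (conj_by G h) \<one>"
    have hG: "h \<in> carrier G" using h by simp
    interpret D: normal ?D G by (rule normal_twisted_class[OF hG D[OF hG]])
    have "?D <#> M \<lhd> G"
      by (rule normal_subgroup_set_mult_closed) (rule D.normal_axioms M(1))+
    moreover have "?D <#> M \<subseteq> K"
      using mono_set_mult[OF twisted_class_subset_normal[OF K h] psubset_imp_subset[OF M(2)], of G]
        subgroup_mult_id[OF K.subgroup_axioms] by simp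
    moreover have "h \<notin> ?D <#> M"
      using twisted_class_mult_normal_imp_mem[OF M(1) hG] False by blast
    ultimately have "?D <#> M \<in> ?S" using h by auto
    moreover have "M \<subseteq> ?D <#> M"
    proof
      fix m
      assume "m \<in> M"
      then show "m \<in> ?D <#> M"
        using set_mult_memI[OF D.one_closed, of m M] by simp
    qed
    ultimately have "?D <#> M = M" by (intro bspec[OF maximal, THEN mp, symmetric])
    moreover have "?D \<subseteq> ?D <#> M"
    proof
      fix d
      assume "d \<in> ?D"
      then show "d \<in> ?D <#> M"
        using set_mult_memI[OF _ M.one_closed, of d ?D] by simp
    qed
    ultimately show ?thesis by blast
  qed
  have "inv x \<otimes> inv y \<otimes> x \<otimes> y \<in> M" if x: "x \<in> K" and y: "y \<in> carrier G" for x y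
  proof -
    \<comment> \<open>The commutator of \<open>x\<close> with \<open>y\<close> is inverse to the one in the twisted class for \<open>x\<close>.\<close>
    have "inv (inv y \<otimes> inv x \<otimes> y \<otimes> x) \<in> M"
      using mem_twisted_class_one[of x y] class_subset[OF x] x y by auto
    then show ?thesis
      using x y by (simp add: inv_mult_group m_assoc)
  qed
  then have "commutator_subgroup G K (carrier G) \<subseteq> M"
    unfolding commutator_subgroup_def
    by (intro generate_subgroup_incl M.subgroup_axioms) auto
  then show thesis using that M by blast
qed

lemma one_in_lower_central: "\<one> \<in> lower_central G n"
  by (cases n) (auto simp: commutator_subgroup_def generate.one)

lemma commutator_subgroup_mono_left:
  assumes "H \<subseteq> H'"
  shows "commutator_subgroup G H K \<subseteq> commutator_subgroup G H' K"
  unfolding commutator_subgroup_def using assms by (intro mono_generate) blast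

text \<open>
  The induction runs on the order of a normal bound \<open>K\<close> for a term of the series: the descent lemma
  turns it into a smaller normal bound for the next term.
\<close>

lemma lower_central_reaches_one:
  assumes fin: "finite (carrier G)"
    and D: "\<And>h. h \<in> carrier G \<Longrightarrow> subgroup (twisted_class G (conj_by G h) \<one>) G"
    and "K \<lhd> G" "lower_central G n \<subseteq> K"
  shows "\<exists>m. lower_central G m = {\<one>}"
  using assms(3,4)
proof (induction "card K" arbitrary: K n rule: less_induct)
  case less
  show ?case
  proof (cases "K = {\<one>}")
    case True
    then show ?thesis using less.prems(2) one_in_lower_central[of n] by blast
  next
    case False
    then obtain M where M: "M \<lhd> G" "M \<subset> K" "commutator_subgroup G K (carrier G) \<subseteq> M"
      using commutator_subgroup_subset_smaller_normal[OF fin D less.prems(1)] by blast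
    have "finite K"
      by (rule finite_subset[OF subgroup.subset[OF normal_imp_subgroup[OF less.prems(1)]] fin])
    then have "card M < card K"
      using M(2) by (rule psubset_card_mono)
    moreover have "lower_central G (Suc n) \<subseteq> M"
      using commutator_subgroup_mono_left[OF less.prems(2)] M(3) by fastforce
    ultimately show ?thesis using less.hyps M(1) by blast
  qed
qed

end

theorem corollary4:
  fixes G (structure)
  assumes "group G"
    and "finite (carrier G)"
    and "\<And>h. h \<in> carrier G \<Longrightarrow> subgroup (twisted_class G (conj_by G h) \<one>) G"
  shows "nilpotent_group G"
proof -
  interpret group G by (rule assms(1))
  have "\<exists>m. lower_central G m = {\<one>}"
    using lower_central_reaches_one[OF assms(2,3) normal_self, of 0] by simp
  then show ?thesis
    using assms(1) by (simp add: nilpotent_group_def)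
qed

end
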